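(* Let $n,m,d,k\ge 1$ be integers with $d\ge m$. Let $f_1,\dots,f_k: M_{n,m}(\mathbb{R})\to\mathbb{R}$ be non-negative and $m$-quasi-concave functions, and let $L_1,\dots,L_k\in M_{d,m}(\mathbb{R})$ be real matrices of rank $m$. Then for every $v\in S^{n-1}$, $$\int_{M_{n,d}(\mathbb{R})}\prod_{i=1}^k f_i(xL_i)\,dx\;\le\;\int_{M_{n,d}(\mathbb{R})}\prod_{i=1}^k f_i^{(v)}(xL_i)\,dx .$$
   Context: $M_{n,m}(\mathbb{R})$ is the space of real matrices with $n$ rows and $m$ columns, with Lebesgue measure from its identification with $\mathbb{R}^{nm}$; $\mathbb{R}^n$ is identified with $M_{n,1}(\mathbb{R})$ (column vectors), and $S^{n-1}\subseteq M_{n,1}(\mathbb{R})$ is the Euclidean unit sphere. $xL_i$ denotes the matrix product. For $v\in S^{n-1}$, let $v^m=\{vt: t\in M_{1,m}(\mathbb{R})\}$ and $v^{\perp m}=\{x\in M_{n,m}(\mathbb{R}): v^{t}x=0\in M_{1,m}(\mathbb{R})\}$ (where $v^{t}$ is the transpose of $v$), so that $M_{n,m}(\mathbb{R})=v^m\oplus v^{\perp m}$. A measurable function $f:M_{n,m}(\mathbb{R})\to\mathbb{R}$ is $m$-quasi-concave if for every $v\in S^{n-1}$ and $y\in v^{\perp m}$ the function $t\in M_{1,m}(\mathbb{R})\mapsto f(y+vt)$ is quasi-concave, i.e. all its super-level sets $\{\cdot\ge s\}$, $s\in\mathbb{R}$, are convex. For $K\subseteq M_{n,m}(\mathbb{R})$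 and $v\in S^{n-1}$, the $m$-th higher-order Steiner symmetrical of $K$ is $$\bar S_vK=\Big\{y+v\tfrac{t-s}{2}: y\in v^{\perp m},\ t,s\in M_{1,m}(\mathbb{R}),\ y+vt\in K,\ y+vs\in K\Big\}.$$ For a non-negative $m$-quasi-concave $f$, its (higher-order) Steiner symmetrical is $f^{(v)}(x)=\int_0^\infty 1_{\bar S_v\{f\ge t\}}(x)\,dt\in[0,\infty]$, where $\{f\ge t\}=\{x: f(x)\ge t\}$ and $1_A$ is the characteristic function of $A$. Integrals take values in $[0,\infty]$, with the usual convention $0\cdot\infty=0$. *)

theory Defs
  imports "HOL-Analysis.Analysis"
begin

text \<open>
  The space of real matrices with \<open>n\<close> rows and \<open>m\<close> columns is \<^typ>\<open>real^'m^'n\<close>, so that column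
  vectors have type \<^typ>\<open>real^1^'n\<close>, row vectors have type \<^typ>\<open>real^'m^1\<close>, and the Euclidean
  norm of a matrix is its Frobenius norm. In particular \<open>sphere 0 1\<close> in \<^typ>\<open>real^1^'n\<close>
  is the Euclidean unit sphere.
\<close>

definition perp_space :: "real^1^'n \<Rightarrow> (real^'m^'n) set" where
  "perp_space v = {x. transpose v ** x = (0 :: real^'m^1)}"

definition quasi_concave :: "('a::real_vector \<Rightarrow> real) \<Rightarrow> bool" where
  "quasi_concave g \<longleftrightarrow> (\<forall>s. convex {t. g t \<ge> s})"

text \<open>
  The number \<open>m\<close> of columns is carried by the type of \<open>f\<close>. Measurable means Lebesgue measurable,
  which includes the Borel measurable functions.
\<close>

definition m_quasi_concave :: "(real^'m^'n \<Rightarrow> real) \<Rightarrow> bool" where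
  "m_quasi_concave f \<longleftrightarrow>
     f \<in> borel_measurable lebesgue \<and>
     (\<forall>v \<in> sphere (0 :: real^1^'n) 1. \<forall>y \<in> perp_space v.
        quasi_concave (\<lambda>t :: real^'m^1. f (y + v ** t)))"

definition steiner_set :: "real^1^'n \<Rightarrow> (real^'m^'n) set \<Rightarrow> (real^'m^'n) set" where
  "steiner_set v K =
     {y + v ** ((1/2) *\<^sub>R (t - s)) | y (t :: real^'m^1) s.
        y \<in> perp_space v \<and> y + v ** t \<in> K \<and> y + v ** s \<in> K}"

definition steiner_fun :: "real^1^'n \<Rightarrow> (real^'m^'n \<Rightarrow> real) \<Rightarrow> real^'m^'n \<Rightarrow> ennreal" where
  "steiner_fun v f x = (\<integral>\<^sup>+ t \<in> {0..}. indicator (steiner_set v {z. f z \<ge> t}) x \<partial>lborel)"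

end

theory Submission
  imports Defs
begin

text \<open>
  Decomposing each \<open>f\<^sub>i\<close> into its super-level sets reduces the claim to sets: for measurable
  \<open>C\<close> in the space of \<open>n \<times> d\<close> matrices, the Steiner symmetral of \<open>C\<close> along \<open>v\<close> has at least the
  volume of \<open>C\<close>, and if \<open>x L\<^sub>i\<close> lies in \<open>K\<^sub>i\<close> for all \<open>x\<close> in \<open>C\<close>, then \<open>x L\<^sub>i\<close> lies in the symmetral
  of \<open>K\<^sub>i\<close> for all \<open>x\<close> in the symmetral of \<open>C\<close>. On each fibre \<open>y + v \<real>\<^sup>d\<close> the volume inequality is
  \<open>|(A - A)/2| \<ge> |A|\<close>, the Brunn-Minkowski inequality for \<open>A\<close> and \<open>-A\<close>, which follows from the
  Prekopa-Leindler inequality.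

  Symmetrals need not be measurable. Those of compact sets are compact, so exhausting \<open>C\<close> by
  compact sets yields a Borel subset of its symmetral that is large enough.
\<close>

section \<open>The Prekopa-Leindler inequality\<close>

lemma ex_initial_part_emeasure_gt:
  fixes A :: "real set"
  assumes [measurable]: "A \<in> sets borel" and c: "c < emeasure lborel A"
  shows "\<exists>a\<in>A. c < emeasure lborel (A \<inter> {..a})"
proof (cases "\<exists>m\<in>A. \<forall>x\<in>A. x \<le> m")
  case True
  then obtain m where "m \<in> A" "\<forall>x\<in>A. x \<le> m" by blast
  moreover from this have "A \<inter> {..m} = A" by auto
  ultimately show ?thesis using c by metis
next
  case False
  have "A \<noteq> {}" using c by auto
  \<comment> \<open>Without a maximum, thresholds can increase to the supremum, finite or infinite,
    and still exhaust \<open>A\<close>. Continuity from below then selects one threshold, and any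
    point of \<open>A\<close> beyond it is a valid cut point inside \<open>A\<close>.\<close>
  have "\<exists>X. incseq X \<and> (\<forall>n. \<exists>a\<in>A. X n \<le> a) \<and> (\<forall>a\<in>A. \<exists>n. a \<le> X n)"
  proof (cases "bdd_above A")
    case bdd: True
    define X where "X n = Sup A - 1 / (real n + 1)" for n
    have "incseq X" unfolding X_def
      by (intro monoI) (simp add: frac_le)
    moreover have "\<exists>a\<in>A. X n \<le> a" for n
    proof -
      have "X n < Sup A" by (simp add: X_def)
      then show ?thesis using bdd \<open>A \<noteq> {}\<close> less_cSup_iff less_imp_le by metis
    qed
    moreover have "\<exists>n. a \<le> X n" if "a \<in> A" for a
    proof -
      have "a < Sup A" using False that bdd
        by (metis cSup_upper dual_order.not_eq_order_implies_strict)
      then obtain n where "inverse (real (Suc n)) < Sup A - a"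
        using reals_Archimedean[of "Sup A - a"] by auto
      then show ?thesis by (intro exI[of _ n]) (simp add: X_def field_simps)
    qed
    ultimately show ?thesis by blast
  next
    case unbdd: False
    then have "\<exists>a\<in>A. real n \<le> a" for n
      by (meson bdd_above.I linorder_le_cases)
    moreover have "\<exists>n. a \<le> real n" for a by (rule real_arch_simple)
    moreover have "incseq real" by (simp add: monoI)
    ultimately show ?thesis by blast
  qed
  then obtain X where X: "incseq X" "\<And>n. \<exists>a\<in>A. X n \<le> a" "\<And>a. a \<in> A \<Longrightarrow> \<exists>n. a \<le> X n"
    by blast
  have "(SUP n. emeasure lborel (A \<inter> {..X n})) = emeasure lborel (\<Union>n. A \<inter> {..X n})"
    using X(1) by (intro SUP_emeasure_incseq) (auto simp: incseq_def intro: order_trans)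
  also have "(\<Union>n. A \<inter> {..X n}) = A" using X(3) by auto
  finally have "c < (SUP n. emeasure lborel (A \<inter> {..X n}))" using c by simp
  then obtain n where n: "c < emeasure lborel (A \<inter> {..X n})"
    by (auto simp: less_SUP_iff)
  obtain a where "a \<in> A" "X n \<le> a" using X(2) by blast
  moreover have "emeasure lborel (A \<inter> {..X n}) \<le> emeasure lborel (A \<inter> {..a})"
    using \<open>X n \<le> a\<close> by (intro emeasure_mono) auto
  ultimately show ?thesis using n by (meson less_le_trans)
qed

lemma emeasure_lborel_uminus:
  fixes A :: "real set"
  assumes [measurable]: "A \<in> sets borel"
  shows "emeasure lborel (uminus ` A) = emeasure lborel A"
proof -
  have "uminus ` A = uminus -` A" by (auto simp: image_iff) (metis minus_minus)
  then show ?thesis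
    using emeasure_distr[of uminus lborel borel A] by (simp add: lborel_distr_uminus)
qed

lemma ex_final_part_emeasure_gt:
  fixes A :: "real set"
  assumes [measurable]: "A \<in> sets borel" and c: "c < emeasure lborel A"
  shows "\<exists>a\<in>A. c < emeasure lborel (A \<inter> {a..})"
proof -
  have m: "uminus ` B \<in> sets borel" if "B \<in> sets borel" for B :: "real set"
  proof -
    have "uminus ` B = uminus -` B" by (auto simp: image_iff) (metis minus_minus)
    then show ?thesis using that measurable_sets[of uminus borel borel B] by simp
  qed
  obtain a where a: "a \<in> A" "c < emeasure lborel (uminus ` A \<inter> {..-a})"
    using ex_initial_part_emeasure_gt[of "uminus ` A" c] m[of A] c
    by (auto simp: emeasure_lborel_uminus)
  have "uminus ` A \<inter> {..-a} = uminus ` (A \<inter> {a..})" by auto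
  then show ?thesis using a by (intro bexI[of _ a]) (auto simp: emeasure_lborel_uminus)
qed

text \<open>For \<open>a\<close> in \<open>A\<close> and \<open>b\<close> in \<open>B\<close>,
  averaging the part of \<open>A\<close> left of \<open>a\<close> with \<open>b\<close>, and the
  part of \<open>B\<close> right of \<open>b\<close> with \<open>a\<close>, gives two subsets of
  \<open>C\<close> on opposite sides of \<open>(a + b) / 2\<close>. They share at most that point,
  so their measures add up. The cut points must belong to the sets because each is also the partner
  of the other part. Suprema over \<open>a\<close> and \<open>b\<close> then recover the full
  measures.\<close>

lemma brunn_minkowski_real:
  fixes A B C :: "real set"
  assumes [measurable]: "A \<in> sets borel" "B \<in> sets borel" "C \<in> sets borel"
    and "A \<noteq> {}" "B \<noteq> {}"
    and mid: "\<And>a b. a \<in> A \<Longrightarrow> b \<in> B \<Longrightarrow> (a + b) / 2 \<in> C"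
  shows "emeasure lborel A + emeasure lborel B \<le> 2 * emeasure lborel C"
proof -
  have parts: "emeasure lborel (A \<inter> {..a}) + emeasure lborel (B \<inter> {b..}) \<le> 2 * emeasure lborel C"
    if ab: "a \<in> A" "b \<in> B" for a b
  proof -
    have eq: "emeasure lborel S = 2 * (\<integral>\<^sup>+c. indicator S (t + 2 * c) \<partial>lborel)"
      if "S \<in> sets borel" for S :: "real set" and t
      using nn_integral_real_affine[of "indicator S" 2 t] that by simp
    have "emeasure lborel (A \<inter> {..a}) + emeasure lborel (B \<inter> {b..}) =
        2 * (\<integral>\<^sup>+c. indicator (A \<inter> {..a}) (-b + 2 * c) + indicator (B \<inter> {b..}) (-a + 2 * c) \<partial>lborel)"
      by (subst nn_integral_add)
        (simp_all add: distrib_left eq[of "A \<inter> {..a}" "-b"] eq[of "B \<inter> {b..}" "-a"])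
    also have "\<dots> \<le> 2 * (\<integral>\<^sup>+c. indicator C c \<partial>lborel)"
    proof (intro mult_left_mono nn_integral_mono_AE)
      show "AE c in lborel. indicator (A \<inter> {..a}) (-b + 2 * c) + indicator (B \<inter> {b..}) (-a + 2 * c)
          \<le> (indicator C c :: ennreal)"
        using AE_lborel_singleton[of "(a + b) / 2"]
      proof eventually_elim
        case (elim c)
        have "c \<in> C" if "-b + 2 * c \<in> A" using mid[OF that ab(2)] by simp
        moreover have "c \<in> C" if "-a + 2 * c \<in> B" using mid[OF ab(1) that] by simp
        ultimately show ?case using elim by (auto simp: indicator_def)
      qed
    qed simp
    finally show ?thesis by simp
  qed
  have partA: "emeasure lborel A + emeasure lborel (B \<inter> {b..}) \<le> 2 * emeasure lborel C"
    if "b \<in> B" for b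
  proof (cases "emeasure lborel A = 0")
    case True
    obtain a where "a \<in> A" using \<open>A \<noteq> {}\<close> by blast
    have "emeasure lborel (B \<inter> {b..}) \<le> emeasure lborel (A \<inter> {..a}) + emeasure lborel (B \<inter> {b..})"
      by simp
    also have "\<dots> \<le> 2 * emeasure lborel C" using parts[OF \<open>a \<in> A\<close> that] .
    finally show ?thesis using True by simp
  next
    case False
    have "emeasure lborel A \<le> (SUP a\<in>A. emeasure lborel (A \<inter> {..a}))"
      using ex_initial_part_emeasure_gt[OF assms(1)]
      by (intro le_SUP_iff[THEN iffD2]) auto
    then have "emeasure lborel A + emeasure lborel (B \<inter> {b..})
        \<le> (SUP a\<in>A. emeasure lborel (A \<inter> {..a})) + emeasure lborel (B \<inter> {b..})"
      by (rule add_right_mono)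
    also have "\<dots> = (SUP a\<in>A. emeasure lborel (A \<inter> {..a}) + emeasure lborel (B \<inter> {b..}))"
      using \<open>A \<noteq> {}\<close> by (simp add: ennreal_SUP_add_left)
    also have "\<dots> \<le> 2 * emeasure lborel C" using parts that by (intro SUP_least) auto
    finally show ?thesis .
  qed
  have "emeasure lborel B \<le> (SUP b\<in>B. emeasure lborel (B \<inter> {b..}))"
    using ex_final_part_emeasure_gt[OF assms(2)]
    by (intro le_SUP_iff[THEN iffD2]) auto
  then have "emeasure lborel A + emeasure lborel B
      \<le> emeasure lborel A + (SUP b\<in>B. emeasure lborel (B \<inter> {b..}))"
    by (rule add_left_mono)
  also have "\<dots> = (SUP b\<in>B. emeasure lborel A + emeasure lborel (B \<inter> {b..}))"
    using \<open>B \<noteq> {}\<close> by (simp add: ennreal_SUP_add_right)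
  also have "\<dots> \<le> 2 * emeasure lborel C" using partA by (intro SUP_least) auto
  finally show ?thesis .
qed

section \<open>Prekopa-Leindler on the line, then in all dimensions\<close>

lemma layer_cake_le_1:
  fixes f :: "real \<Rightarrow> ennreal"
  assumes [measurable]: "f \<in> borel_measurable borel"
  shows "(\<integral>\<^sup>+t\<in>{0<..<1}. emeasure lborel {x. ennreal t < f x} \<partial>lborel) = (\<integral>\<^sup>+x. min 1 (f x) \<partial>lborel)"
proof -
  have "(\<integral>\<^sup>+t\<in>{0<..<1}. emeasure lborel {x. ennreal t < f x} \<partial>lborel) =
      (\<integral>\<^sup>+t. \<integral>\<^sup>+x. indicator {x. ennreal t < f x} x * indicator {0<..<1} t \<partial>lborel \<partial>lborel)"
    by (intro nn_integral_cong) (simp add: nn_integral_multc)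
  also have "\<dots> = (\<integral>\<^sup>+x. \<integral>\<^sup>+t. indicator {x. ennreal t < f x} x * indicator {0<..<1} t \<partial>lborel \<partial>lborel)"
    by (intro lborel_pair.Fubini') (simp add: indicator_def of_bool_def)
  also have "\<dots> = (\<integral>\<^sup>+x. min 1 (f x) \<partial>lborel)"
  proof (intro nn_integral_cong)
    fix x
    have "(\<integral>\<^sup>+t. indicator {x. ennreal t < f x} x * indicator {0<..<1} t \<partial>lborel) =
      emeasure lborel {t. ennreal t < f x \<and> t \<in> {0<..<1}}"
      by (subst nn_integral_indicator[symmetric])
        (auto simp: indicator_def simp del: nn_integral_indicator intro!: nn_integral_cong)
    also have "\<dots> = min 1 (f x)"
    proof (cases "f x" rule: ennreal_cases)
      case (real r)
      have "{t. ennreal t < f x \<and> t \<in> {0<..<1}} = {0<..<min 1 r}"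
        using real by (auto simp: ennreal_less_iff)
      then show ?thesis using real by (simp add: min_def)
    next
      case top
      then have "{t. ennreal t < f x \<and> t \<in> {0<..<1}} = {0<..<1}" by auto
      then show ?thesis using top by simp
    qed
    finally show "(\<integral>\<^sup>+t. indicator {x. ennreal t < f x} x * indicator {0<..<1} t \<partial>lborel) = min 1 (f x)" .
  qed
  finally show ?thesis .
qed

lemma arith_geo_mean_ennreal:
  fixes x y :: ennreal
  shows "4 * (x * y) \<le> (x + y)\<^sup>2"
proof (cases "x = top \<or> y = top")
  case True
  then show ?thesis by (auto simp: power2_eq_square ennreal_top_mult ennreal_mult_top)
next
  case False
  then obtain a b where ab: "x = ennreal a" "0 \<le> a" "y = ennreal b" "0 \<le> b"
    by (metis ennreal_cases)
  have "4 * (a * b) \<le> (a + b)\<^sup>2"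
    using sum_squares_ge_zero[of "a - b" 0] by (simp add: power2_eq_square algebra_simps)
  then have "ennreal (4 * (a * b)) \<le> ennreal ((a + b)\<^sup>2)" by (rule ennreal_leI)
  then show ?thesis using ab
    by (simp add: ennreal_mult ennreal_power[symmetric] flip: ennreal_plus)
qed

lemma ennreal_power2_strict_mono:
  fixes a b :: ennreal
  assumes "a < b"
  shows "a\<^sup>2 < b\<^sup>2"
proof (cases "b = top")
  case True
  then show ?thesis using assms by (simp add: power2_eq_square ennreal_mult_less_top)
next
  case False
  then obtain x y where "a = ennreal x" "0 \<le> x" "b = ennreal y" "0 \<le> y"
    using assms by (metis ennreal_cases top.not_eq_extremum less_top less_trans)
  then show ?thesis using assms
    by (simp add: ennreal_power ennreal_less_iff power_strict_mono)
qed

text \<open>With both suprema equal to 1, every level \<open>t\<close> in (0,1) has non-empty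
  super-level sets of \<open>f\<close> and \<open>g\<close>, as Brunn-Minkowski requires, and these
  levels account for the whole integrals of \<open>f\<close> and \<open>g\<close>. Integrating over
  \<open>t\<close> gives an additive inequality, and the arithmetic-geometric mean inequality turns
  the sum into a product.\<close>

lemma prekopa_leindler_normalized:
  fixes f g h :: "real \<Rightarrow> ennreal"
  assumes [measurable]: "f \<in> borel_measurable borel" "g \<in> borel_measurable borel"
      "h \<in> borel_measurable borel"
    and le: "\<And>x y. f x * g y \<le> (h ((x + y) / 2))\<^sup>2"
    and f: "(SUP x. f x) = 1" and g: "(SUP x. g x) = 1"
  shows "(\<integral>\<^sup>+x. f x \<partial>lborel) * (\<integral>\<^sup>+x. g x \<partial>lborel) \<le> (\<integral>\<^sup>+x. h x \<partial>lborel)\<^sup>2"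
proof -
  have min: "min 1 (f x) = f x" "min 1 (g x) = g x" for x
    using SUP_upper[of x UNIV f] SUP_upper[of x UNIV g] f g by (auto simp: min_def)
  have "(\<integral>\<^sup>+x. f x \<partial>lborel) + (\<integral>\<^sup>+x. g x \<partial>lborel) =
     (\<integral>\<^sup>+t\<in>{0<..<1}. emeasure lborel {x. ennreal t < f x} \<partial>lborel) +
     (\<integral>\<^sup>+t\<in>{0<..<1}. emeasure lborel {x. ennreal t < g x} \<partial>lborel)"
    by (simp add: layer_cake_le_1 min)
  also have "\<dots> = (\<integral>\<^sup>+t. (emeasure lborel {x. ennreal t < f x} + emeasure lborel {x. ennreal t < g x})
      * indicator {0<..<1} t \<partial>lborel)"
    by (subst nn_integral_add[symmetric]) (auto simp: distrib_right)
  also have "\<dots> \<le> (\<integral>\<^sup>+t. 2 * (emeasure lborel {x. ennreal t < h x} * indicator {0<..<1} t) \<partial>lborel)"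
  proof (intro nn_integral_mono)
    fix t :: real
    have "emeasure lborel {x. ennreal t < f x} + emeasure lborel {x. ennreal t < g x} \<le>
      2 * emeasure lborel {x. ennreal t < h x}" if t: "0 < t" "t < 1"
    proof (rule brunn_minkowski_real)
      have "\<exists>x. ennreal t < F x" if "(SUP x. F x) = 1" for F :: "real \<Rightarrow> ennreal"
      proof -
        have "ennreal t < (SUP x. F x)" using t that by simp
        then show ?thesis by (auto simp: less_SUP_iff)
      qed
      from this[OF f] this[OF g]
      show "{x. ennreal t < f x} \<noteq> {}" "{x. ennreal t < g x} \<noteq> {}" by auto
    next
      fix a b assume "a \<in> {x. ennreal t < f x}" "b \<in> {x. ennreal t < g x}"
      then have lt: "ennreal t < min (f a) (g b)" by simp
      \<comment> \<open>The minimum exceeds \<open>t\<close>, and its square is at most the square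
        of \<open>h\<close> at the midpoint; hence \<open>h\<close> exceeds \<open>t\<close>
        there.\<close>
      have "(min (f a) (g b))\<^sup>2 \<le> f a * g b"
        by (simp add: power2_eq_square mult_mono)
      also note le
      finally have "min (f a) (g b) \<le> h ((a + b) / 2)"
        by (meson ennreal_power2_strict_mono not_le)
      with lt have "ennreal t < h ((a + b) / 2)" by (rule less_le_trans)
      then show "(a + b) / 2 \<in> {x. ennreal t < h x}" by simp
    qed measurable
    then show "(emeasure lborel {x. ennreal t < f x} + emeasure lborel {x. ennreal t < g x})
      * indicator {0<..<1} t \<le> 2 * (emeasure lborel {x. ennreal t < h x} * indicator {0<..<1} t)"
      by (auto simp: indicator_def)
  qed
  also have "\<dots> = 2 * (\<integral>\<^sup>+x. min 1 (h x) \<partial>lborel)"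
    by (subst nn_integral_cmult) (auto simp: layer_cake_le_1)
  also have "\<dots> \<le> 2 * (\<integral>\<^sup>+x. h x \<partial>lborel)"
    by (intro mult_left_mono nn_integral_mono) auto
  finally have *: "(\<integral>\<^sup>+x. f x \<partial>lborel) + (\<integral>\<^sup>+x. g x \<partial>lborel) \<le> 2 * (\<integral>\<^sup>+x. h x \<partial>lborel)" .
  have "4 * ((\<integral>\<^sup>+x. f x \<partial>lborel) * (\<integral>\<^sup>+x. g x \<partial>lborel)) \<le>
    ((\<integral>\<^sup>+x. f x \<partial>lborel) + (\<integral>\<^sup>+x. g x \<partial>lborel))\<^sup>2"
    by (rule arith_geo_mean_ennreal)
  also have "\<dots> \<le> (2 * (\<integral>\<^sup>+x. h x \<partial>lborel))\<^sup>2"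
    using * by (intro power_mono) auto
  also have "\<dots> = 4 * (\<integral>\<^sup>+x. h x \<partial>lborel)\<^sup>2"
    by (simp add: power_mult_distrib)
  finally show ?thesis
    by (subst (asm) ennreal_mult_le_mult_iff) auto
qed

lemma prekopa_leindler_bounded:
  fixes f g h :: "real \<Rightarrow> ennreal"
  assumes [measurable]: "f \<in> borel_measurable borel" "g \<in> borel_measurable borel"
      "h \<in> borel_measurable borel"
    and le: "\<And>x y. f x * g y \<le> (h ((x + y) / 2))\<^sup>2"
    and f: "(SUP x. f x) < top" and g: "(SUP x. g x) < top"
  shows "(\<integral>\<^sup>+x. f x \<partial>lborel) * (\<integral>\<^sup>+x. g x \<partial>lborel) \<le> (\<integral>\<^sup>+x. h x \<partial>lborel)\<^sup>2"
proof (cases "(SUP x. f x) = 0 \<or> (SUP x. g x) = 0")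
  case True
  then have "(\<forall>x. f x = 0) \<or> (\<forall>x. g x = 0)"
    by (metis SUP_upper UNIV_I le_zero_eq)
  then show ?thesis by auto
next
  case False
  define a b where "a = enn2real (SUP x. f x)" and "b = enn2real (SUP x. g x)"
  have a: "(SUP x. f x) = ennreal a" "a > 0" and b: "(SUP x. g x) = ennreal b" "b > 0"
    using False f g by (auto simp: a_def b_def enn2real_positive_iff zero_less_iff_neq_zero)
  define A B where "A = ennreal (1 / a)" and "B = ennreal (1 / b)"
  \<comment> \<open>Scaling \<open>f\<close> and \<open>g\<close> to supremum 1 multiplies the left
    side of the hypothesis by \<open>A * B\<close>, so \<open>h\<close> has to be scaled by the
    geometric mean of the two factors.\<close>
  define S where "S = ennreal (sqrt (1 / a * (1 / b)))"
  have S: "S\<^sup>2 = A * B" using a b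
    unfolding S_def A_def B_def by (subst ennreal_power) (auto simp: ennreal_mult[symmetric])
  have "(\<integral>\<^sup>+x. A * f x \<partial>lborel) * (\<integral>\<^sup>+x. B * g x \<partial>lborel) \<le> (\<integral>\<^sup>+x. S * h x \<partial>lborel)\<^sup>2"
  proof (rule prekopa_leindler_normalized)
    show "(A * f x) * (B * g y) \<le> (S * h ((x + y) / 2))\<^sup>2" for x y
    proof -
      have "(A * f x) * (B * g y) = (A * B) * (f x * g y)" by (simp add: ac_simps)
      also have "\<dots> \<le> (A * B) * (h ((x + y) / 2))\<^sup>2" by (intro mult_left_mono le) simp
      finally show ?thesis by (simp add: power_mult_distrib S)
    qed
    show "(SUP x. A * f x) = 1" "(SUP x. B * g x) = 1"
      using a b by (auto simp: SUP_mult_left_ennreal[symmetric] A_def B_def ennreal_mult[symmetric])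
  qed measurable
  then have "(A * B) * ((\<integral>\<^sup>+x. f x \<partial>lborel) * (\<integral>\<^sup>+x. g x \<partial>lborel)) \<le> (A * B) * (\<integral>\<^sup>+x. h x \<partial>lborel)\<^sup>2"
    by (simp add: nn_integral_cmult power_mult_distrib S ac_simps)
  moreover have "A * B = ennreal (1 / a * (1 / b))" using a b by (simp add: A_def B_def ennreal_mult[symmetric])
  ultimately show ?thesis
    using a b by (subst (asm) ennreal_mult_le_mult_iff) auto
qed

text \<open>Truncating \<open>f\<close> and \<open>g\<close> from above only lowers the left side of
  the hypothesis, so \<open>h\<close> stays unchanged; monotone convergence removes the two
  truncations independently.\<close>

lemma prekopa_leindler_real:
  fixes f g h :: "real \<Rightarrow> ennreal"
  assumes [measurable]: "f \<in> borel_measurable borel" "g \<in> borel_measurable borel"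
      "h \<in> borel_measurable borel"
    and le: "\<And>x y. f x * g y \<le> (h ((x + y) / 2))\<^sup>2"
  shows "(\<integral>\<^sup>+x. f x \<partial>lborel) * (\<integral>\<^sup>+x. g x \<partial>lborel) \<le> (\<integral>\<^sup>+x. h x \<partial>lborel)\<^sup>2"
proof -
  have inc: "incseq (\<lambda>N x. min (of_nat N) (F x))" for F :: "real \<Rightarrow> ennreal"
    by (auto simp: incseq_def le_fun_def min.coboundedI1)
  have sup: "(SUP N. min (of_nat N) y) = y" for y :: ennreal
  proof -
    have "(SUP N. inf y (of_nat N)) = inf y (SUP N. of_nat N)"
      by (rule inf_SUP[symmetric])
    then show ?thesis by (simp add: ennreal_SUP_of_nat_eq_top inf_min min.commute)
  qed
  have trunc: "(\<integral>\<^sup>+x. F x \<partial>lborel) = (SUP N. \<integral>\<^sup>+x. min (of_nat N) (F x) \<partial>lborel)"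
    if [measurable]: "F \<in> borel_measurable borel" for F :: "real \<Rightarrow> ennreal"
    by (subst nn_integral_monotone_convergence_SUP[symmetric, OF inc]) (simp_all add: sup)
  have "(\<integral>\<^sup>+x. min (of_nat M) (f x) \<partial>lborel) * (\<integral>\<^sup>+x. min (of_nat N) (g x) \<partial>lborel)
      \<le> (\<integral>\<^sup>+x. h x \<partial>lborel)\<^sup>2" for M N
  proof (rule prekopa_leindler_bounded)
    show "min (of_nat M) (f x) * min (of_nat N) (g y) \<le> (h ((x + y) / 2))\<^sup>2" for x y
      by (rule order_trans[OF _ le[of x y]]) (intro mult_mono, auto)
    have "(SUP x. min (of_nat N) (F x)) \<le> of_nat N" for F :: "real \<Rightarrow> ennreal" and N
      by (intro SUP_least) auto
    then show "(SUP x. min (of_nat M) (f x)) < top" "(SUP x. min (of_nat N) (g x)) < top"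
      by (meson le_less_trans of_nat_less_top)+
  qed measurable
  then show ?thesis
    by (auto simp: trunc[of f] trunc[of g] SUP_mult_left_ennreal SUP_mult_right_ennreal intro!: SUP_least)
qed

text \<open>Induction on the coordinates: integrating out coordinate \<open>i\<close> yields
  functions of the remaining ones that again satisfy the midpoint hypothesis, which is exactly the
  one-dimensional inequality applied to the sections. Points are kept extensional so that they lie
  in the product space, where sections are measurable.\<close>

lemma prekopa_leindler_PiM:
  fixes f g h :: "('i \<Rightarrow> real) \<Rightarrow> ennreal"
  assumes "finite I"
    and "f \<in> borel_measurable (\<Pi>\<^sub>M i\<in>I. lborel)" "g \<in> borel_measurable (\<Pi>\<^sub>M i\<in>I. lborel)"
      "h \<in> borel_measurable (\<Pi>\<^sub>M i\<in>I. lborel)"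
    and "\<And>x y. x \<in> extensional I \<Longrightarrow> y \<in> extensional I \<Longrightarrow> f x * g y \<le> (h (\<lambda>i\<in>I. (x i + y i) / 2))\<^sup>2"
  shows "(\<integral>\<^sup>+x. f x \<partial>(\<Pi>\<^sub>M i\<in>I. lborel)) * (\<integral>\<^sup>+x. g x \<partial>(\<Pi>\<^sub>M i\<in>I. lborel))
    \<le> (\<integral>\<^sup>+x. h x \<partial>(\<Pi>\<^sub>M i\<in>I. lborel))\<^sup>2"
  using assms
proof (induction I arbitrary: f g h rule: finite_induct)
  case empty
  have "f (\<lambda>_. undefined) * g (\<lambda>_. undefined) \<le> (h (\<lambda>_. undefined))\<^sup>2"
    using empty(4)[of "\<lambda>_. undefined" "\<lambda>_. undefined"] by (simp add: restrict_def)
  then show ?case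
    by (simp add: PiM_empty nn_integral_count_space_finite)
next
  case (insert i I)
  interpret product_sigma_finite "\<lambda>_::'i. lborel :: real measure" by standard
  interpret I: finite_product_sigma_finite "\<lambda>_::'i. lborel :: real measure" I
    using insert by unfold_locales
  note [measurable] = insert.prems(1-3)
  define F G H where "F x = (\<integral>\<^sup>+t. f (x(i := t)) \<partial>lborel)" and "G x = (\<integral>\<^sup>+t. g (x(i := t)) \<partial>lborel)"
    and "H x = (\<integral>\<^sup>+t. h (x(i := t)) \<partial>lborel)" for x
  have "(\<integral>\<^sup>+x. F x \<partial>Pi\<^sub>M I (\<lambda>_. lborel)) * (\<integral>\<^sup>+x. G x \<partial>Pi\<^sub>M I (\<lambda>_. lborel))
    \<le> (\<integral>\<^sup>+x. H x \<partial>Pi\<^sub>M I (\<lambda>_. lborel))\<^sup>2"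
  proof (rule insert.IH)
    show "F \<in> borel_measurable (\<Pi>\<^sub>M i\<in>I. lborel)" "G \<in> borel_measurable (\<Pi>\<^sub>M i\<in>I. lborel)"
      "H \<in> borel_measurable (\<Pi>\<^sub>M i\<in>I. lborel)"
      unfolding F_def G_def H_def by measurable
    fix x y :: "'i \<Rightarrow> real" assume xy: "x \<in> extensional I" "y \<in> extensional I"
    let ?z = "\<lambda>i\<in>I. (x i + y i) / 2"
    have upd[measurable]: "(\<lambda>t. k (w(i := t))) \<in> borel_measurable borel"
      if "k \<in> borel_measurable (Pi\<^sub>M (insert i I) (\<lambda>_. lborel))" "w \<in> extensional I"
      for k :: "('i \<Rightarrow> real) \<Rightarrow> ennreal" and w
    proof -
      have "(\<lambda>t. w(i := t)) \<in> lborel \<rightarrow>\<^sub>M Pi\<^sub>M (insert i I) (\<lambda>_. lborel)"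
        using that(2) insert.hyps by (intro measurable_component_update) (auto simp: space_PiM PiE_def)
      from measurable_comp[OF this that(1)] show ?thesis by (simp add: comp_def)
    qed
    have upd_ext: "w(i := t) \<in> extensional (insert i I)" if "w \<in> extensional I" for w :: "'i \<Rightarrow> real" and t
      using that by (auto simp: extensional_def)
    show "F x * G y \<le> (H ?z)\<^sup>2"
      unfolding F_def G_def H_def
    proof (rule prekopa_leindler_real)
      fix s t :: real
      have "(\<lambda>j\<in>insert i I. ((x(i := s)) j + (y(i := t)) j) / 2) = ?z(i := (s + t) / 2)"
        using insert.hyps by (auto simp: fun_eq_iff)
      then show "f (x(i := s)) * g (y(i := t)) \<le> (h (?z(i := (s + t) / 2)))\<^sup>2"
        using insert.prems(4)[of "x(i := s)" "y(i := t)"] xy by (simp only: upd_ext)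
    qed (use xy insert.prems in \<open>auto intro!: upd\<close>)
  qed
  then show ?case
    using insert.hyps by (simp add: product_nn_integral_insert F_def G_def H_def)
qed

lemma prekopa_leindler:
  fixes f g h :: "'a::euclidean_space \<Rightarrow> ennreal"
  assumes [measurable]: "f \<in> borel_measurable borel" "g \<in> borel_measurable borel"
      "h \<in> borel_measurable borel"
    and le: "\<And>x y. f x * g y \<le> (h ((1/2) *\<^sub>R (x + y)))\<^sup>2"
  shows "(\<integral>\<^sup>+x. f x \<partial>lborel) * (\<integral>\<^sup>+x. g x \<partial>lborel) \<le> (\<integral>\<^sup>+x. h x \<partial>lborel)\<^sup>2"
proof -
  let ?P = "\<Pi>\<^sub>M b\<in>Basis. lborel :: ('a \<Rightarrow> real) measure"
  let ?c = "\<lambda>p. \<Sum>b\<in>Basis. p b *\<^sub>R b :: 'a"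
  have eq: "(\<integral>\<^sup>+x. k x \<partial>lborel) = (\<integral>\<^sup>+p. k (?c p) \<partial>?P)"
    if [measurable]: "k \<in> borel_measurable borel" for k :: "'a \<Rightarrow> ennreal"
    by (subst lborel_eq, subst nn_integral_distr) simp_all
  have "(\<integral>\<^sup>+p. f (?c p) \<partial>?P) * (\<integral>\<^sup>+p. g (?c p) \<partial>?P) \<le> (\<integral>\<^sup>+p. h (?c p) \<partial>?P)\<^sup>2"
  proof (rule prekopa_leindler_PiM)
    fix p q :: "'a \<Rightarrow> real"
    have "?c (\<lambda>b\<in>Basis. (p b + q b) / 2) = (1/2) *\<^sub>R (?c p + ?c q)"
      by (simp add: scaleR_sum_right sum.distrib[symmetric] scaleR_add_left[symmetric] add_divide_distrib scaleR_add_right)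
    then show "f (?c p) * g (?c q) \<le> (h (?c (\<lambda>b\<in>Basis. (p b + q b) / 2)))\<^sup>2"
      using le[of "?c p" "?c q"] by simp
  qed simp_all
  then show ?thesis by (simp add: eq)
qed

text \<open>Prekopa-Leindler for the indicators of \<open>A\<close>, its reflection and
  \<open>B\<close>. Reflection preserves volume, so the product on the left is the square of the
  volume of \<open>A\<close>.\<close>

lemma emeasure_half_difference_set_ge:
  fixes A B :: "'a::euclidean_space set"
  assumes [measurable]: "A \<in> sets borel" "B \<in> sets borel"
    and mid: "\<And>a a'. a \<in> A \<Longrightarrow> a' \<in> A \<Longrightarrow> (1/2) *\<^sub>R (a - a') \<in> B"
  shows "emeasure lborel A \<le> emeasure lborel B"
proof -
  have "(\<integral>\<^sup>+x. indicator A x \<partial>lborel) * (\<integral>\<^sup>+x. indicator A (- x) \<partial>lborel)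
      \<le> (\<integral>\<^sup>+x. indicator B x \<partial>(lborel :: 'a measure))\<^sup>2"
  proof (rule prekopa_leindler)
    fix x y :: 'a
    have "(1/2) *\<^sub>R (x + y) \<in> B" if "x \<in> A" "- y \<in> A" using mid[OF that] by simp
    then show "indicator A x * indicator A (- y) \<le> ((indicator B ((1/2) *\<^sub>R (x + y)))\<^sup>2 :: ennreal)"
      by (auto simp: indicator_def)
  qed measurable
  moreover have "(\<integral>\<^sup>+x. indicator A (- x) \<partial>lborel) = emeasure lborel A"
  proof -
    have "(\<integral>\<^sup>+x. indicator A x \<partial>lborel) = (\<integral>\<^sup>+x. indicator A x \<partial>(distr lborel borel uminus))"
      using lborel_affine[of "-1" "0::'a"] by (simp add: density_1 one_ennreal_def[symmetric])
    then show ?thesis by (subst (asm) nn_integral_distr) simp_all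
  qed
  ultimately have "(emeasure lborel A)\<^sup>2 \<le> (emeasure lborel B)\<^sup>2"
    by (simp add: power2_eq_square)
  then show ?thesis
    by (meson ennreal_power2_strict_mono not_le)
qed

section \<open>Volume of Steiner symmetrals\<close>

lemma nn_integral_lborel_translation:
  fixes f :: "'a::euclidean_space \<Rightarrow> ennreal"
  assumes [measurable]: "f \<in> borel_measurable borel"
  shows "(\<integral>\<^sup>+x. f (x + c) \<partial>lborel) = (\<integral>\<^sup>+x. f x \<partial>lborel)"
proof -
  have "(\<integral>\<^sup>+x. f x \<partial>lborel) = (\<integral>\<^sup>+x. f x \<partial>distr lborel borel ((+) c))"
    by (simp add: lborel_distr_plus)
  then show ?thesis by (simp add: nn_integral_distr add.commute)
qed

lemma nn_integral_lborel_reflection: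
  fixes f :: "'a::euclidean_space \<Rightarrow> ennreal"
  assumes [measurable]: "f \<in> borel_measurable borel"
  shows "(\<integral>\<^sup>+x. f (c - x) \<partial>lborel) = (\<integral>\<^sup>+x. f x \<partial>lborel)"
proof -
  have "(\<integral>\<^sup>+x. f x \<partial>lborel) = (\<integral>\<^sup>+x. f x \<partial>distr lborel borel (\<lambda>x. c + (-1) *\<^sub>R x))"
    using lborel_affine[of "-1" c] by (simp add: density_1 one_ennreal_def[symmetric])
  then show ?thesis by (simp add: nn_integral_distr)
qed

text \<open>
  Averaging over the translates \<open>x + V u\<close>, localised by a window of volume 1, replaces Fubini's
  theorem along the fibres \<open>x + range V\<close> and avoids coordinates on a complement of \<open>range V\<close>.
\<close>

lemma emeasure_lborel_fibres:
  fixes V :: "'b::euclidean_space \<Rightarrow> 'a::euclidean_space" and P :: "'a \<Rightarrow> 'b"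
  assumes "linear V" "linear P" and PV: "\<And>u. P (V u) = u" and [measurable]: "C \<in> sets borel"
  shows "emeasure lborel C =
    (\<integral>\<^sup>+x. indicator (cbox 0 One) (P x) * emeasure lborel {u. x + V u \<in> C} \<partial>lborel)"
proof -
  have [measurable]: "V \<in> borel_measurable borel" "P \<in> borel_measurable borel"
    using assms by (auto intro!: borel_measurable_continuous_onI linear_continuous_on
        simp: linear_conv_bounded_linear[symmetric])
  have window: "emeasure lborel (cbox 0 (One::'b)) = 1"
    by (subst emeasure_lborel_cbox) auto
  have "(\<integral>\<^sup>+x. indicator (cbox 0 One) (P x) * emeasure lborel {u. x + V u \<in> C} \<partial>lborel) =
    (\<integral>\<^sup>+x. \<integral>\<^sup>+u. indicator (cbox 0 One) (P x) * indicator C (x + V u) \<partial>lborel \<partial>lborel)"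
  proof (rule nn_integral_cong)
    fix x
    have "emeasure lborel {u. x + V u \<in> C} = (\<integral>\<^sup>+u. indicator C (x + V u) \<partial>lborel)"
      by (subst nn_integral_indicator[symmetric])
        (auto simp: indicator_def simp del: nn_integral_indicator intro!: nn_integral_cong)
    then show "indicator (cbox 0 One) (P x) * emeasure lborel {u. x + V u \<in> C} =
      (\<integral>\<^sup>+u. indicator (cbox 0 One) (P x) * indicator C (x + V u) \<partial>lborel)"
      by (simp add: nn_integral_cmult)
  qed
  also have "\<dots> = (\<integral>\<^sup>+u. \<integral>\<^sup>+x. indicator (cbox 0 One) (P x) * indicator C (x + V u) \<partial>lborel \<partial>lborel)"
    by (intro lborel_pair.Fubini') simp
  \<comment> \<open>Substituting \<open>x - V u\<close> for \<open>x\<close> moves the translation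
    from \<open>C\<close> to the window, because \<open>P (V u) = u\<close>.\<close>
  also have "\<dots> = (\<integral>\<^sup>+u. \<integral>\<^sup>+x. indicator (cbox 0 One) (P x - u) * indicator C x \<partial>lborel \<partial>lborel)"
  proof (rule nn_integral_cong)
    fix u
    have "P (x + V u) - u = P x" for x using linear_add[OF assms(2)] PV by simp
    then show "(\<integral>\<^sup>+x. indicator (cbox 0 One) (P x) * indicator C (x + V u) \<partial>lborel) =
      (\<integral>\<^sup>+x. indicator (cbox 0 One) (P x - u) * indicator C x \<partial>lborel)"
      by (subst (2) nn_integral_lborel_translation[symmetric, of _ "V u"]) simp_all
  qed
  also have "\<dots> = (\<integral>\<^sup>+x. \<integral>\<^sup>+u. indicator (cbox 0 One) (P x - u) * indicator C x \<partial>lborel \<partial>lborel)"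
    by (intro lborel_pair.Fubini') simp
  \<comment> \<open>With \<open>u\<close> innermost, the window integrates to 1 whatever the value
    of \<open>P x\<close>.\<close>
  also have "\<dots> = (\<integral>\<^sup>+x. indicator C x \<partial>lborel)"
    by (intro nn_integral_cong)
      (simp add: nn_integral_multc nn_integral_lborel_reflection[of "indicator (cbox 0 One)"] window)
  finally show ?thesis by simp
qed

text \<open>Beyond Borel measurability, preimages of null sets must be null. Along each fibre
  \<open>x + V u\<close>, the preimage of \<open>Z\<close> is a translate of \<open>Z\<close>, so
  the fibre formula gives it volume 0.\<close>

lemma measurable_lebesgue_linear_split_surjective:
  fixes V :: "'b::euclidean_space \<Rightarrow> 'a::euclidean_space" and P :: "'a \<Rightarrow> 'b"
  assumes "linear V" "linear P" and PV: "\<And>u. P (V u) = u"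
  shows "P \<in> lebesgue \<rightarrow>\<^sub>M lebesgue"
proof (rule completion.measurable_completion2)
  have [measurable]: "P \<in> borel_measurable borel"
    using assms by (auto intro!: borel_measurable_continuous_onI linear_continuous_on
        simp: linear_conv_bounded_linear[symmetric])
  show P: "P \<in> lebesgue \<rightarrow>\<^sub>M lborel" by (intro measurable_completion) simp
  show "null_sets lborel \<subseteq> null_sets (distr lebesgue lborel P)"
  proof
    fix Z :: "'b set" assume Z: "Z \<in> null_sets lborel"
    then have [measurable]: "Z \<in> sets borel" by auto
    have PZ: "P -` Z \<in> sets borel"
      using measurable_sets[of P borel borel Z] by simp
    have "{u. x + V u \<in> P -` Z} = (\<lambda>u. u + P x) -` Z" for x
      using linear_add[OF assms(2)] PV by (auto simp: add.commute)
    moreover have "emeasure lborel ((\<lambda>u. u + P x) -` Z) = 0" for x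
    proof -
      have "(\<lambda>u. u + P x) -` Z \<in> sets borel"
        using measurable_sets[of "\<lambda>u. u + P x" borel borel Z] by simp
      then have "emeasure lborel ((\<lambda>u. u + P x) -` Z) = (\<integral>\<^sup>+u. indicator Z (u + P x) \<partial>lborel)"
        by (subst nn_integral_indicator[symmetric])
          (auto simp: indicator_def simp del: nn_integral_indicator intro!: nn_integral_cong)
      then show ?thesis using Z by (simp add: nn_integral_lborel_translation null_sets_def)
    qed
    ultimately have "emeasure lborel (P -` Z) = 0"
      by (simp add: emeasure_lborel_fibres[OF assms PZ])
    then show "Z \<in> null_sets (distr lebesgue lborel P)"
      using PZ P by (simp add: null_sets_def emeasure_distr)
  qed
qed

section \<open>Splitting matrices along \<open>v\<close>, and the volume of symmetrals\<close>

lemma linear_matrix_mult_left: "linear (\<lambda>x::real^'p^'q. A ** x)"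
  by (auto intro!: linearI simp: matrix_matrix_mult_def vec_eq_iff sum.distrib sum_distrib_left algebra_simps)

lemma linear_matrix_mult_right: "linear (\<lambda>x::real^'p^'q. x ** B)"
  by (auto intro!: linearI simp: matrix_matrix_mult_def vec_eq_iff sum.distrib sum_distrib_left algebra_simps)

lemma transpose_mult_self_unit:
  fixes v :: "real^1^'n"
  assumes "v \<in> sphere 0 1"
  shows "transpose v ** v = mat 1"
proof -
  have "(\<Sum>i\<in>UNIV. v $ i $ 1 * v $ i $ 1) = v \<bullet> v" by (simp add: inner_vec_def)
  also have "\<dots> = 1" using assms by (simp add: norm_eq_1)
  finally show ?thesis by (simp add: vec_eq_iff matrix_matrix_mult_def transpose_def mat_def forall_1)
qed

lemma perp_space_mult: "y \<in> perp_space v \<Longrightarrow> y ** B \<in> perp_space v"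
  by (simp add: perp_space_def matrix_mul_assoc)

lemma steiner_set_mono: "K \<subseteq> K' \<Longrightarrow> steiner_set v K \<subseteq> steiner_set v K'"
  unfolding steiner_set_def by blast

context
  fixes v :: "real^1^'n"
  assumes v: "v \<in> sphere 0 1"
begin

lemma projection_mult: "transpose v ** (v ** u) = u"
  by (simp add: matrix_mul_assoc transpose_mult_self_unit[OF v])

lemma minus_projection_in_perp_space: "x - v ** (transpose v ** x) \<in> perp_space v"
  by (simp only: perp_space_def mem_Collect_eq linear_diff[OF linear_matrix_mult_left] projection_mult)
    simp

text \<open>The data \<open>y\<close>, \<open>t\<close>, \<open>s\<close> are recovered from the two
  points of \<open>K\<close>: their common component orthogonal to \<open>v\<close>, and their
  coordinates along \<open>v\<close>. The symmetral is thus a continuous image of a relatively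
  closed subset of \<open>K \<times> K\<close>, which gives its compactness when \<open>K\<close> is
  compact.\<close>

lemma steiner_set_eq_image:
  fixes K :: "(real^'m^'n) set"
  shows "steiner_set v K =
    (\<lambda>(x, x'). x - v ** (transpose v ** x) + v ** ((1/2) *\<^sub>R (transpose v ** x - transpose v ** x'))) `
    {(x, x') \<in> K \<times> K. x - v ** (transpose v ** x) = x' - v ** (transpose v ** x')}"
  (is "_ = ?r")
proof
  show "steiner_set v K \<subseteq> ?r"
  proof
    fix z assume "z \<in> steiner_set v K"
    then obtain y t s where z: "z = y + v ** ((1/2) *\<^sub>R (t - s))" and y: "y \<in> perp_space v"
      and K: "y + v ** t \<in> K" "y + v ** s \<in> K"
      unfolding steiner_set_def by blast
    have "transpose v ** (y + v ** t) = t" for t :: "real^'m^1"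
      using y by (simp add: matrix_add_ldistrib projection_mult perp_space_def)
    then show "z \<in> ?r"
      using z K by (intro image_eqI[of _ _ "(y + v ** t, y + v ** s)"]) auto
  qed
  show "?r \<subseteq> steiner_set v K"
  proof clarify
    fix x x' assume K: "x \<in> K" "x' \<in> K"
      and eq: "x - v ** (transpose v ** x) = x' - v ** (transpose v ** x')"
    have "x - v ** (transpose v ** x) + v ** (transpose v ** x) \<in> K" using K by simp
    moreover have "x - v ** (transpose v ** x) + v ** (transpose v ** x') \<in> K"
      using K unfolding eq by simp
    ultimately show "x - v ** (transpose v ** x) + v ** ((1/2) *\<^sub>R (transpose v ** x - transpose v ** x'))
      \<in> steiner_set v K"
      unfolding steiner_set_def using minus_projection_in_perp_space[of x] by blast
  qed
qed

lemma compact_steiner_set: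
  fixes K :: "(real^'m^'n) set"
  assumes "compact K"
  shows "compact (steiner_set v K)"
proof -
  have c: "continuous_on UNIV (\<lambda>x::real^'p^'q. A ** x)" for A :: "real^'q^'r"
    using linear_matrix_mult_left
    by (intro linear_continuous_on) (simp add: linear_conv_bounded_linear[symmetric])
  have cont: "continuous_on S (\<lambda>x. A ** g x)" if "continuous_on S g"
    for S :: "'z::topological_space set" and A :: "real^'q^'r" and g :: "'z \<Rightarrow> real^'p^'q"
    using continuous_on_compose2[OF c that] by auto
  have "compact (K \<times> K)" using assms by (simp add: compact_Times)
  moreover have "closed {p. fst p - v ** (transpose v ** fst p) = snd p - v ** (transpose v ** (snd p :: real^'m^'n))}"
    by (intro closed_Collect_eq continuous_intros cont)
  ultimately have "compact ((K \<times> K) \<inter> {p. fst p - v ** (transpose v ** fst p) = snd p - v ** (transpose v ** snd p)})"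
    by (rule compact_Int_closed)
  moreover have "(K \<times> K) \<inter> {p. fst p - v ** (transpose v ** fst p) = snd p - v ** (transpose v ** snd p)}
    = {(x, x') \<in> K \<times> K. x - v ** (transpose v ** x) = x' - v ** (transpose v ** x')}"
    by auto
  ultimately show ?thesis
    unfolding steiner_set_eq_image
    by (intro compact_continuous_image)
      (auto simp: case_prod_beta intro!: continuous_intros cont)
qed

lemma emeasure_steiner_set_compact_ge:
  fixes K :: "(real^'m^'n) set"
  assumes "compact K"
  shows "emeasure lborel K \<le> emeasure lborel (steiner_set v K)"
proof -
  let ?V = "\<lambda>u::real^'m^1. v ** u" and ?P = "\<lambda>x::real^'m^'n. transpose v ** x"
  have [measurable]: "K \<in> sets borel" "steiner_set v K \<in> sets borel"
    using assms compact_steiner_set by (auto intro: borel_compact)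
  have lin: "linear ?V" "linear ?P" by (rule linear_matrix_mult_left)+
  have [measurable]: "?V \<in> borel_measurable borel"
    using lin by (auto intro!: borel_measurable_continuous_onI linear_continuous_on
        simp: linear_conv_bounded_linear[symmetric])
  note fibres = emeasure_lborel_fibres[OF lin projection_mult]
  have "emeasure lborel {u. x + ?V u \<in> K} \<le> emeasure lborel {u. x + ?V u \<in> steiner_set v K}" for x
  proof -
    let ?B = "{u. x + ?V u \<in> steiner_set v K}"
    \<comment> \<open>The fibre is parametrised from \<open>x\<close>, whose coordinate along
      \<open>v\<close> is \<open>?P x\<close>, whereas half differences are measured from the
      orthogonal part of \<open>x\<close>. The shift by \<open>- ?P x\<close> corrects this and does
      not affect volume.\<close>
    have "emeasure lborel {u. x + ?V u \<in> K} \<le> emeasure lborel {u. u + - ?P x \<in> ?B}"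
    proof (rule emeasure_half_difference_set_ge)
      fix a a' assume a: "a \<in> {u. x + ?V u \<in> K}" "a' \<in> {u. x + ?V u \<in> K}"
      have "x - ?V (?P x) + ?V (?P x + b) = x + ?V b" for b
        by (simp add: matrix_add_ldistrib)
      moreover have "x + ?V ((1/2) *\<^sub>R (a - a') + - ?P x) =
        x - ?V (?P x) + ?V ((1/2) *\<^sub>R ((?P x + a) - (?P x + a')))"
        by (simp add: linear_diff[OF lin(1)])
      ultimately show "(1/2) *\<^sub>R (a - a') \<in> {u. u + - ?P x \<in> ?B}"
        using a minus_projection_in_perp_space[of x]
        unfolding steiner_set_def mem_Collect_eq by metis
    qed measurable
    also have "\<dots> = (\<integral>\<^sup>+u. indicator ?B (u + - ?P x) \<partial>lborel)"
      by (subst nn_integral_indicator[symmetric])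
        (auto simp: indicator_def simp del: nn_integral_indicator intro!: nn_integral_cong)
    also have "\<dots> = emeasure lborel ?B"
      by (subst nn_integral_lborel_translation) auto
    finally show ?thesis .
  qed
  then show ?thesis
    by (subst (1 2) fibres) (auto intro!: nn_integral_mono mult_left_mono)
qed

text \<open>Up to a null set, \<open>C\<close> is a countable union of compact sets. Finite unions
  make the sequence increasing, so its volumes converge to that of \<open>C\<close>; the union of
  the compact symmetrals is Borel and lies in the symmetral of \<open>C\<close> by
  monotonicity.\<close>

lemma ex_borel_subset_steiner_set:
  fixes C :: "(real^'m^'n) set"
  assumes "C \<in> sets lebesgue"
  shows "\<exists>M\<in>sets borel. M \<subseteq> steiner_set v C \<and> emeasure lebesgue C \<le> emeasure lborel M"
proof -
  obtain D T where D: "fsigma D" "T \<in> null_sets lebesgue" "D \<union> T = C" "disjnt D T"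
    using lebesgue_set_almost_fsigma[OF assms] .
  obtain F where F: "\<And>n::nat. compact (F n)" "D = (\<Union>n. F n)"
    using D(1) fsigma_Union_compact[of D] by (metis image_subset_iff mem_Collect_eq UNIV_I)
  define K where "K n = (\<Union>m\<le>n. F m)" for n
  have K: "compact (K n)" for n using F by (auto simp: K_def intro!: compact_UN)
  have KD: "(\<Union>n. K n) = D" unfolding F K_def by auto
  have "incseq K" unfolding K_def by (intro monoI UN_mono) auto
  let ?M = "\<Union>n. steiner_set v (K n)"
  have [measurable]: "K n \<in> sets borel" "steiner_set v (K n) \<in> sets borel" for n
    using K compact_steiner_set by (auto intro: borel_compact)
  have "emeasure lebesgue C = emeasure lebesgue D"
    using D(2,3) emeasure_Un_null_set[of D lebesgue T] by (auto simp: KD[symmetric])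
  also have "\<dots> = (SUP n. emeasure lborel (K n))"
    using \<open>incseq K\<close> by (subst SUP_emeasure_incseq) (auto simp: KD[symmetric])
  also have "\<dots> \<le> (SUP n. emeasure lborel (steiner_set v (K n)))"
    by (intro SUP_mono') (rule emeasure_steiner_set_compact_ge[OF K])
  also have "\<dots> \<le> emeasure lborel ?M"
    by (intro SUP_least emeasure_mono) auto
  finally have "emeasure lebesgue C \<le> emeasure lborel ?M" .
  moreover have "?M \<subseteq> steiner_set v C"
    using steiner_set_mono[of "K n" C for n] KD D(3) by blast
  ultimately show ?thesis by (intro bexI[of _ ?M]) auto
qed

end

text \<open>Right multiplication respects the splitting along \<open>v\<close>: it sends
  \<open>y + v ** t\<close> to \<open>y ** B + v ** (t ** B)\<close>, and \<open>y ** B\<close> is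
  still orthogonal to \<open>v\<close>. Two points of \<open>C\<close> on one fibre therefore go to
  two points of \<open>K\<close> on one fibre, and half differences go to half differences.\<close>

lemma steiner_set_mult_subset:
  fixes B :: "real^'m^'d" and K :: "(real^'m^'n) set"
  assumes "x \<in> steiner_set v C" and "\<And>z. z \<in> C \<Longrightarrow> z ** B \<in> K"
  shows "x ** B \<in> steiner_set v K"
proof -
  obtain y t s where x: "x = y + v ** ((1/2) *\<^sub>R (t - s))" and y: "y \<in> perp_space v"
    and C: "y + v ** t \<in> C" "y + v ** s \<in> C"
    using assms(1) unfolding steiner_set_def by blast
  have *: "(y + v ** t) ** B = y ** B + v ** (t ** B)" for t
    using linear_add[OF linear_matrix_mult_right[of B]] by (simp add: matrix_mul_assoc)
  have "x ** B = y ** B + v ** ((1/2) *\<^sub>R (t ** B - s ** B))"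
    by (simp only: x * linear_diff[OF linear_matrix_mult_right] linear_scale[OF linear_matrix_mult_right])
  moreover have "y ** B + v ** (t ** B) \<in> K" "y ** B + v ** (s ** B) \<in> K"
    using assms(2)[OF C(1)] assms(2)[OF C(2)] by (simp_all add: *)
  ultimately show ?thesis unfolding steiner_set_def using perp_space_mult[OF y] by blast
qed

section \<open>Integrals of products\<close>

text \<open>A lower Riemann sum with mesh \<open>1 / N\<close> for the integral over levels.
  Symmetrals shrink as the level rises, so if \<open>m\<close> is the largest index that counts, the
  integrand is 1 on all of \<open>[0, m / N]\<close>, while at most \<open>m\<close> terms are
  nonzero.\<close>

lemma steiner_fun_ge_sum:
  fixes f :: "real^'m^'n \<Rightarrow> real"
  shows "(\<Sum>j=1..J. ennreal (1 / real N) * indicator (steiner_set v {z. f z \<ge> real j / real N}) x)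
    \<le> steiner_fun v f x"
proof -
  define T where "T = {j\<in>{1..J}. x \<in> steiner_set v {z. f z \<ge> real j / real N}}"
  have [simp]: "finite T" by (simp add: T_def)
  have sum: "(\<Sum>j=1..J. ennreal (1 / real N) * indicator (steiner_set v {z. f z \<ge> real j / real N}) x)
    = ennreal (real (card T) / real N)"
  proof -
    have "(\<Sum>j=1..J. ennreal (1 / real N) * indicator (steiner_set v {z. f z \<ge> real j / real N}) x)
      = (\<Sum>j\<in>T. ennreal (1 / real N))"
      unfolding T_def by (intro sum.mono_neutral_cong_right) auto
    then show ?thesis by (simp add: ennreal_of_nat_eq_real_of_nat ennreal_mult[symmetric])
  qed
  show ?thesis
  proof (cases "T = {}")
    case True
    then show ?thesis unfolding sum by simp
  next
    case False
    define m where "m = Max T"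
    have "m \<in> T" using False by (simp add: m_def)
    have "T \<subseteq> {1..m}" by (auto simp: m_def T_def[symmetric]) (auto simp: T_def)
    then have "card T \<le> m" using card_mono[of "{1..m}" T] by simp
    then have "ennreal (real (card T) / real N) \<le> ennreal (real m / real N)"
      by (intro ennreal_leI divide_right_mono) auto
    also have "\<dots> = (\<integral>\<^sup>+t. indicator {0..real m / real N} t \<partial>lborel)" by simp
    also have "\<dots> \<le> steiner_fun v f x"
      unfolding steiner_fun_def
    proof (intro nn_integral_mono)
      fix t :: real
      have "x \<in> steiner_set v {z. f z \<ge> t}" if "t \<le> real m / real N"
      proof -
        have "{z. f z \<ge> real m / real N} \<subseteq> {z. f z \<ge> t}" using that by auto
        from steiner_set_mono[OF this] \<open>m \<in> T\<close> show ?thesis unfolding T_def by blast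
      qed
      then show "indicator {0..real m / real N} t \<le>
          (indicator (steiner_set v {z. f z \<ge> t}) x * indicator {0..} t :: ennreal)"
        by (auto simp: indicator_def)
    qed
    finally show ?thesis unfolding sum .
  qed
qed

text \<open>The \<open>N * N\<close> steps of height \<open>1 / N\<close> reach up to level
  \<open>N\<close>, so range and resolution improve together. Once \<open>N\<close> is positive and
  at least \<open>a\<close>, the sum is \<open>a\<close> rounded down to a multiple of
  \<open>1 / N\<close>.\<close>

lemma staircase_tendsto:
  assumes "0 \<le> (a::real)"
  shows "(\<lambda>N. \<Sum>j=1..N * N. 1 / real N * indicator {r. r \<le> a} (real j / real N)) \<longlonglongrightarrow> a"
proof (rule tendsto_sandwich)
  have eq: "(\<Sum>j=1..N * N. 1 / real N * indicator {r. r \<le> a} (real j / real N)) =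
    real (nat \<lfloor>a * real N\<rfloor>) / real N" if N: "0 < N" "a \<le> real N" for N
  proof -
    have le: "real j / real N \<le> a \<longleftrightarrow> j \<le> nat \<lfloor>a * real N\<rfloor>" for j
      using N assms by (simp add: divide_le_eq le_nat_iff le_floor_iff)
    have "a * real N \<le> real (N * N)" using N by (simp add: mult_right_mono)
    then have "nat \<lfloor>a * real N\<rfloor> \<le> N * N" by linarith
    then have "{j\<in>{1..N * N}. real j / real N \<le> a} = {1..nat \<lfloor>a * real N\<rfloor>}" unfolding le by auto
    moreover have "(\<Sum>j=1..N * N. 1 / real N * indicator {r. r \<le> a} (real j / real N)) =
        (\<Sum>j\<in>{j\<in>{1..N * N}. real j / real N \<le> a}. 1 / real N)"
      by (intro sum.mono_neutral_cong_right) auto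
    ultimately show ?thesis by simp
  qed
  have ev: "\<forall>\<^sub>F N in sequentially. 0 < N \<and> a \<le> real N"
    using eventually_gt_at_top[of "0::nat"] eventually_ge_at_top[of "nat \<lceil>a\<rceil>"]
    by eventually_elim linarith
  show "\<forall>\<^sub>F N in sequentially. a - 1 / real N \<le>
      (\<Sum>j=1..N * N. 1 / real N * indicator {r. r \<le> a} (real j / real N))"
    using ev
  proof eventually_elim
    case (elim N)
    have "a * real N - 1 \<le> real (nat \<lfloor>a * real N\<rfloor>)" by linarith
    then have "(a * real N - 1) / real N \<le> real (nat \<lfloor>a * real N\<rfloor>) / real N"
      by (rule divide_right_mono) simp
    moreover have "(a * real N - 1) / real N = a - 1 / real N"
      using elim by (simp add: diff_divide_distrib)
    ultimately show ?case unfolding eq[OF conjunct1[OF elim] conjunct2[OF elim]] by simp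
  qed
  show "\<forall>\<^sub>F N in sequentially.
      (\<Sum>j=1..N * N. 1 / real N * indicator {r. r \<le> a} (real j / real N)) \<le> a"
    using ev
  proof eventually_elim
    case (elim N)
    have "real (nat \<lfloor>a * real N\<rfloor>) \<le> a * real N" using assms by simp
    then show ?case unfolding eq[OF conjunct1[OF elim] conjunct2[OF elim]]
      using elim by (simp add: field_simps)
  qed
  show "(\<lambda>N. a - 1 / real N) \<longlonglongrightarrow> a"
    using tendsto_diff[OF tendsto_const lim_1_over_n, of a] by simp
qed simp

text \<open>Full column rank gives a left inverse \<open>R\<close> of \<open>B\<close>, and
  \<open>u ** R\<close> is then a linear right inverse of multiplication by \<open>B\<close>. This
  keeps the integrand measurable when the \<open>f i\<close> are only Lebesgue measurable.\<close>

lemma measurable_lebesgue_mult_full_rank: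
  fixes B :: "real^'m^'d"
  assumes "rank B = CARD('m)"
  shows "(\<lambda>x::real^'d^'n. x ** B) \<in> lebesgue \<rightarrow>\<^sub>M lebesgue"
proof -
  obtain R where R: "R ** B = mat 1"
    using assms full_rank_injective matrix_left_invertible_injective by metis
  have "u ** R ** B = u" for u :: "real^'m^'n"
    using R by (metis matrix_mul_assoc matrix_mul_rid)
  then show ?thesis
    by (intro measurable_lebesgue_linear_split_surjective[where V = "\<lambda>u. u ** R"]
        linear_matrix_mult_right)
qed

theorem theorem1p10:
  fixes k :: nat
    and f :: "nat \<Rightarrow> real^'m^'n \<Rightarrow> real"
    and L :: "nat \<Rightarrow> real^'m^'d"
    and v :: "real^1^'n"
  assumes "CARD('m) \<le> CARD('d)"
    and "1 \<le> k"
    and "\<And>i x. i \<in> {1..k} \<Longrightarrow> 0 \<le> f i x"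
    and "\<And>i. i \<in> {1..k} \<Longrightarrow> m_quasi_concave (f i)"
    and "\<And>i. i \<in> {1..k} \<Longrightarrow> rank (L i) = CARD('m)"
    and "v \<in> sphere 0 1"
  shows "(\<integral>\<^sup>+ (x :: real^'d^'n). ennreal (\<Prod>i=1..k. f i (x ** L i)) \<partial>lebesgue)
       \<le> (\<integral>\<^sup>+ (x :: real^'d^'n). (\<Prod>i=1..k. steiner_fun v (f i) (x ** L i)) \<partial>lebesgue)"
    (is "?lhs \<le> ?rhs")
proof -
  let ?I = "{1..k}"
  have meas: "(\<lambda>x. f i (x ** L i)) \<in> borel_measurable (lebesgue :: (real^'d^'n) measure)"
    if "i \<in> ?I" for i
    using measurable_compose[OF measurable_lebesgue_mult_full_rank[OF assms(5)[OF that]]]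
      assms(4)[OF that] by (auto simp: m_quasi_concave_def)
  define C where "C N j = {x::real^'d^'n. \<forall>i\<in>?I. real (j i) / real N \<le> f i (x ** L i)}"
    for N :: nat and j :: "nat \<Rightarrow> nat"
  have C: "C N j \<in> sets lebesgue" for N j
  proof -
    have "{x \<in> space lebesgue. \<forall>i\<in>?I. real (j i) / real N \<le> f i (x ** L i)} \<in> sets (lebesgue :: (real^'d^'n) measure)"
      by (intro sets.sets_Collect_finite_All' borel_measurable_le meas) (use assms(2) in auto)
    then show ?thesis by (simp add: C_def)
  qed
  obtain M where M: "\<And>N j. M N j \<in> sets borel" "\<And>N j. M N j \<subseteq> steiner_set v (C N j)"
      "\<And>N j. emeasure lebesgue (C N j) \<le> emeasure lborel (M N j)"
    using ex_borel_subset_steiner_set[OF assms(6) C] by metis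
  define \<phi> where "\<phi> N a = (\<Sum>j=1..N * N. 1 / real N * indicator {r. r \<le> a} (real j / real N))"
    for N :: nat and a :: real
  have \<phi>_nonneg: "0 \<le> \<phi> N a" for N a by (simp add: \<phi>_def sum_nonneg)
  have \<phi>_ennreal: "ennreal (\<phi> N a) =
      (\<Sum>j=1..N * N. ennreal (1 / real N) * indicator {r. r \<le> a} (real j / real N))" for N a
  proof -
    have "(\<Sum>j=1..N * N. ennreal (1 / real N) * indicator {r. r \<le> a} (real j / real N)) =
        (\<Sum>j=1..N * N. ennreal (1 / real N * indicator {r. r \<le> a} (real j / real N)))"
      by (intro sum.cong refl) (simp split: split_indicator)
    also have "\<dots> = ennreal (\<phi> N a)" unfolding \<phi>_def by (rule sum_ennreal) simp
    finally show ?thesis ..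
  qed
  let ?J = "\<lambda>N. PiE ?I (\<lambda>_. {1..N * N})"
  have step: "(\<integral>\<^sup>+x. ennreal (\<Prod>i\<in>?I. \<phi> N (f i (x ** L i))) \<partial>lebesgue) \<le> ?rhs" for N
  proof -
    \<comment> \<open>Expanding the product of staircases gives one term for each choice
      \<open>j\<close> of a level per factor; the product of its indicators is the indicator of
      \<open>C N j\<close>.\<close>
    have "ennreal (\<Prod>i\<in>?I. \<phi> N (f i (x ** L i))) =
        (\<Sum>j\<in>?J N. ennreal (1 / real N) ^ k * indicator (C N j) x)" for x :: "real^'d^'n"
    proof -
      have "ennreal (\<Prod>i\<in>?I. \<phi> N (f i (x ** L i))) = (\<Prod>i\<in>?I. ennreal (\<phi> N (f i (x ** L i))))"
        by (simp add: prod_ennreal \<phi>_nonneg)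
      also have "\<dots> = (\<Prod>i\<in>?I. \<Sum>j=1..N * N. ennreal (1 / real N) *
          indicator {r. r \<le> f i (x ** L i)} (real j / real N))"
        by (simp add: \<phi>_ennreal)
      also have "\<dots> = (\<Sum>j\<in>?J N. \<Prod>i\<in>?I. ennreal (1 / real N) *
          indicator {r. r \<le> f i (x ** L i)} (real (j i) / real N))"
        by (rule prod_sum_PiE) auto
      also have "\<dots> = (\<Sum>j\<in>?J N. ennreal (1 / real N) ^ k * indicator (C N j) x)"
      proof (intro sum.cong refl)
        fix j
        have "(\<Prod>i\<in>?I. indicator {r. r \<le> f i (x ** L i)} (real (j i) / real N)) = (indicator (C N j) x :: ennreal)"
        proof (cases "x \<in> C N j")
          case True
          then show ?thesis by (auto simp: C_def intro!: prod.neutral)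
        next
          case False
          then obtain i where "i \<in> ?I" "\<not> real (j i) / real N \<le> f i (x ** L i)"
            by (auto simp: C_def)
          then show ?thesis using False by (auto intro!: prod_zero bexI[of _ i])
        qed
        then show "(\<Prod>i\<in>?I. ennreal (1 / real N) * indicator {r. r \<le> f i (x ** L i)} (real (j i) / real N))
            = ennreal (1 / real N) ^ k * indicator (C N j) x"
          by (simp add: prod.distrib)
      qed
      finally show ?thesis .
    qed
    then have "(\<integral>\<^sup>+x. ennreal (\<Prod>i\<in>?I. \<phi> N (f i (x ** L i))) \<partial>lebesgue) =
        (\<Sum>j\<in>?J N. ennreal (1 / real N) ^ k * emeasure lebesgue (C N j))"
      using C by (simp add: nn_integral_sum nn_integral_cmult)
    also have "\<dots> \<le> (\<Sum>j\<in>?J N. ennreal (1 / real N) ^ k * emeasure lborel (M N j))"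
      using M by (intro sum_mono mult_left_mono) auto
    also have "\<dots> = (\<integral>\<^sup>+x. (\<Sum>j\<in>?J N. ennreal (1 / real N) ^ k * indicator (M N j) x) \<partial>lborel)"
      using M by (simp add: nn_integral_sum nn_integral_cmult)
    \<comment> \<open>The right integrand is not known to be measurable, so only monotonicity of the
      integral is applied to it; additivity was used for the Borel sets \<open>M N j\<close> alone.
      Pointwise, the sum over \<open>j\<close> refolds into a product of the lower Riemann sums of
      the symmetrals.\<close>
    also have "\<dots> \<le> (\<integral>\<^sup>+x. (\<Prod>i\<in>?I. steiner_fun v (f i) (x ** L i)) \<partial>lborel)"
    proof (intro nn_integral_mono)
      fix x :: "real^'d^'n"
      let ?S = "\<lambda>i r. steiner_set v {z. f i z \<ge> r}"
      have "(\<Sum>j\<in>?J N. ennreal (1 / real N) ^ k * indicator (M N j) x) \<le>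
          (\<Sum>j\<in>?J N. \<Prod>i\<in>?I. ennreal (1 / real N) * indicator (?S i (real (j i) / real N)) (x ** L i))"
      proof (intro sum_mono)
        fix j
        have "x ** L i \<in> ?S i (real (j i) / real N)" if "x \<in> M N j" "i \<in> ?I" for i
          using that M(2) by (intro steiner_set_mult_subset[of x v "C N j"]) (auto simp: C_def)
        then show "ennreal (1 / real N) ^ k * indicator (M N j) x \<le>
            (\<Prod>i\<in>?I. ennreal (1 / real N) * indicator (?S i (real (j i) / real N)) (x ** L i))"
          by (cases "x \<in> M N j") (auto simp: prod.distrib)
      qed
      also have "\<dots> = (\<Prod>i\<in>?I. \<Sum>j=1..N * N. ennreal (1 / real N) *
          indicator (?S i (real j / real N)) (x ** L i))"
        by (rule prod_sum_PiE[symmetric]) auto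
      also have "\<dots> \<le> (\<Prod>i\<in>?I. steiner_fun v (f i) (x ** L i))"
        by (intro prod_mono_ennreal steiner_fun_ge_sum)
      finally show "(\<Sum>j\<in>?J N. ennreal (1 / real N) ^ k * indicator (M N j) x)
        \<le> (\<Prod>i\<in>?I. steiner_fun v (f i) (x ** L i))" .
    qed
    also have "\<dots> = ?rhs" by (simp add: nn_integral_completion)
    finally show ?thesis .
  qed
  \<comment> \<open>Rounding down to multiples of \<open>1 / N\<close> is not monotone in
    \<open>N\<close>, so the limit is taken with Fatou's lemma; the bound by \<open>?rhs\<close> is
    uniform in \<open>N\<close>.\<close>
  have "?lhs = (\<integral>\<^sup>+x. liminf (\<lambda>N. ennreal (\<Prod>i\<in>?I. \<phi> N (f i (x ** L i)))) \<partial>lebesgue)"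
  proof (rule nn_integral_cong)
    fix x :: "real^'d^'n"
    have "(\<lambda>N. ennreal (\<Prod>i\<in>?I. \<phi> N (f i (x ** L i)))) \<longlonglongrightarrow> ennreal (\<Prod>i\<in>?I. f i (x ** L i))"
      unfolding \<phi>_def using assms(3) by (intro tendsto_ennrealI tendsto_prod staircase_tendsto) auto
    then show "ennreal (\<Prod>i\<in>?I. f i (x ** L i)) = liminf (\<lambda>N. ennreal (\<Prod>i\<in>?I. \<phi> N (f i (x ** L i))))"
      by (simp add: lim_imp_Liminf)
  qed
  also have "\<dots> \<le> liminf (\<lambda>N. \<integral>\<^sup>+x. ennreal (\<Prod>i\<in>?I. \<phi> N (f i (x ** L i))) \<partial>lebesgue)"
  proof (rule nn_integral_liminf)
    have [measurable]: "\<phi> N \<in> borel_measurable borel" for N unfolding \<phi>_def by measurable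
    show "(\<lambda>x. ennreal (\<Prod>i\<in>?I. \<phi> N (f i (x ** L i)))) \<in> borel_measurable lebesgue" for N
      using meas by (intro measurable_compose[OF _ measurable_ennreal] borel_measurable_prod
          measurable_compose[of "\<lambda>x. f i (x ** L i)" lebesgue borel "\<phi> N" borel for i]) auto
  qed
  also have "\<dots> \<le> ?rhs" using step by (intro Liminf_le) auto
  finally show ?thesis .
qed

end
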